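(* Let $p>2$ be a prime, let $n\geq 1$ be an integer, and let $A:=(\mathbb{Z}_p)^n$. Suppose that $A$ satisfies Property D. Then $$ s(A)\leq (p-1)\,p^{\left(1-\frac{(p-2)^2}{2p^2\ln(p)}\right)n+1}+1. $$
   Context: A sequence over a finite abelian group $A$ is a finite unordered list of elements of $A$ with repetitions allowed (an element of the free abelian monoid on $A$); its length is the number of terms counted with multiplicity, a subsequence is a sub-multiset, and a zero-sum sequence is one whose terms sum to $0$. For a sequence $T$, $T^{j}$ denotes the sequence in which every term of $T$ is repeated $j$ times. The exponent $\exp(A)$ is the least common multiple of the orders of elements of $A$. The Erdős–Ginzburg–Ziv constant $s(A)$ is the smallest integer $\ell$ such that every sequence over $A$ of length at least $\ell$ has a zero-sum subsequence of length $\exp(A)$. The group $A=(\mathbb{Z}_k)^n$ is said to satisfy Property D if every sequence $S$ over $A$ of length $s(A)-1$ that has no zero-sum subsequence of length $k$ has the form $S=T^{k-1}$ for some sequence $T$ over $A$. *)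

theory Defs
  imports Complex_Main "HOL-Library.Multiset" "HOL-Algebra.Product_Groups"
    "HOL-Algebra.Multiplicative_Group" "HOL-Computational_Algebra.Primes"
begin

text \<open>Abelian groups are \<open>comm_group\<close> records, hence written multiplicatively: the sum of a
  sequence is a \<open>\<otimes>\<close>-product and ``zero-sum'' means that this product is \<open>\<one>\<close>.\<close>

definition sequence_over :: "('a, 'b) monoid_scheme \<Rightarrow> 'a multiset \<Rightarrow> bool" where
  "sequence_over G S \<longleftrightarrow> set_mset S \<subseteq> carrier G"

text \<open>The \<open>\<otimes>\<close> of a locale group is commutative only on the carrier, so \<open>sum_mset\<close> and
  \<open>fold_mset\<close> do not apply; equal terms are collected into powers instead.\<close>

definition seq_sum :: "('a, 'b) monoid_scheme \<Rightarrow> 'a multiset \<Rightarrow> 'a" where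
  "seq_sum G S = (\<Otimes>\<^bsub>G\<^esub>g\<in>set_mset S. g [^]\<^bsub>G\<^esub> count S g)"

definition zero_sum :: "('a, 'b) monoid_scheme \<Rightarrow> 'a multiset \<Rightarrow> bool" where
  "zero_sum G S \<longleftrightarrow> seq_sum G S = \<one>\<^bsub>G\<^esub>"

definition has_zero_sum_subseq :: "('a, 'b) monoid_scheme \<Rightarrow> nat \<Rightarrow> 'a multiset \<Rightarrow> bool" where
  "has_zero_sum_subseq G k S \<longleftrightarrow> (\<exists>U. U \<subseteq># S \<and> size U = k \<and> zero_sum G U)"

definition group_exponent :: "('a, 'b) monoid_scheme \<Rightarrow> nat" where
  "group_exponent G = Lcm (group.ord G ` carrier G)"

definition egz_const :: "('a, 'b) monoid_scheme \<Rightarrow> nat" where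
  "egz_const G = (LEAST l. \<forall>S. sequence_over G S \<and> l \<le> size S
                       \<longrightarrow> has_zero_sum_subseq G (group_exponent G) S)"

definition Zmod_power :: "nat \<Rightarrow> nat \<Rightarrow> (nat \<Rightarrow> int) monoid" where
  "Zmod_power k n = product_group {..<n} (\<lambda>_. integer_mod_group k)"

definition property_D :: "nat \<Rightarrow> nat \<Rightarrow> bool" where
  "property_D k n \<longleftrightarrow>
     (\<forall>S. sequence_over (Zmod_power k n) S \<and> size S + 1 = egz_const (Zmod_power k n)
            \<and> \<not> has_zero_sum_subseq (Zmod_power k n) k S
        \<longrightarrow> (\<exists>T. sequence_over (Zmod_power k n) T \<and> S = repeat_mset (k - 1) T))"

end

theory Submission
  imports Defs "HOL-Number_Theory.Residues"
begin

text \<open>Property D makes an extremal sequence the \<open>(p - 1)\<close>-fold repetition of a set \<open>A\<close> in which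
  \<open>x\<^sub>1 + \<dots> + x\<^sub>p = 0\<close> has only the solutions \<open>x\<^sub>1 = \<dots> = x\<^sub>p\<close>. Hence on \<open>A\<^sup>p\<close> the polynomial
  \<open>\<Prod>\<^sub>j (1 - (x\<^sub>1\<^sub>j + \<dots> + x\<^sub>p\<^sub>j)\<^bsup>p - 1\<^esup>)\<close> is the diagonal tensor, whose slice rank over \<open>\<int>/p\<close> is \<open>|A|\<close>
  (Tao). Each of its monomials has degree at most \<open>(p - 1) n / p\<close> in one of the \<open>p\<close> blocks of
  variables, so the slice rank is at most \<open>p\<close> times the number of such monomials with exponents
  below \<open>p\<close> in one block, which a Chernoff-Hoeffding estimate bounds by
  \<open>p\<^sup>n exp (- (p - 2)\<^sup>2 n / (2 p\<^sup>2))\<close>.\<close>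

section \<open>Slice rank of diagonal tensors modulo a prime\<close>

text \<open>There is no type of integers modulo a variable prime, so linear algebra over the prime field
  is expressed by divisibility of integers.\<close>

lemma underdetermined_system_mod_prime:
  fixes p :: int and f :: "'i \<Rightarrow> 'v \<Rightarrow> int"
  assumes "prime p" "finite I" "finite A" "card I < card A"
  shows "\<exists>h. (\<exists>x\<in>A. \<not> p dvd h x) \<and> (\<forall>i\<in>I. p dvd (\<Sum>x\<in>A. h x * f i x))"
  using assms(2-)
proof (induction I arbitrary: A f rule: finite_induct)
  case empty
  then obtain x where "x \<in> A" by fastforce
  then show ?case
    using assms(1) not_prime_unit by (intro exI[of _ "\<lambda>_. 1"]) auto
next
  case (insert i I A f)
  show ?case
  proof (cases "\<forall>x\<in>A. p dvd f i x")
    case True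
    from insert have "card I < card A" by simp
    with insert.IH[OF insert.prems(1), of f] obtain h where
      "\<exists>x\<in>A. \<not> p dvd h x" "\<forall>i\<in>I. p dvd (\<Sum>x\<in>A. h x * f i x)"
      by blast
    moreover have "p dvd (\<Sum>x\<in>A. h x * f i x)"
      using True by (intro dvd_sum) auto
    ultimately show ?thesis by blast
  next
    case False
    then obtain a where a: "a \<in> A" "\<not> p dvd f i a" by blast
    \<comment> \<open>Gaussian elimination with pivot \<open>f i a\<close>: cross-multiplication
      with row \<open>i\<close> cancels the coefficient at \<open>a\<close> in every row without any
      division.\<close>
    define f' where "f' j x = f i a * f j x - f j a * f i x" for j x
    have "card I < card (A - {a})"
      using insert a by (simp add: card_Diff_singleton)
    with insert.IH[of "A - {a}" f'] insert.prems obtain h' where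
      h': "\<exists>x\<in>A - {a}. \<not> p dvd h' x" "\<And>j. j \<in> I \<Longrightarrow> p dvd (\<Sum>x\<in>A - {a}. h' x * f' j x)"
      by auto
    \<comment> \<open>Back substitution, scaled by the pivot: the value at \<open>a\<close> solves
      row \<open>i\<close> exactly, and the other values stay nonzero mod \<open>p\<close> because
      the pivot is a unit.\<close>
    define h where "h x = (if x = a then - (\<Sum>x\<in>A - {a}. h' x * f i x) else f i a * h' x)" for x
    have sum_h: "(\<Sum>x\<in>A. h x * f j x) = (\<Sum>x\<in>A - {a}. h' x * f' j x)" for j
    proof -
      have "(\<Sum>x\<in>A. h x * f j x) = h a * f j a + (\<Sum>x\<in>A - {a}. h x * f j x)"
        using insert.prems a by (simp add: sum.remove)
      also have "(\<Sum>x\<in>A - {a}. h x * f j x) = (\<Sum>x\<in>A - {a}. f i a * h' x * f j x)"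
        by (intro sum.cong) (auto simp: h_def)
      also have "h a * f j a = (\<Sum>x\<in>A - {a}. - (h' x * f i x * f j a))"
        by (simp add: h_def sum_distrib_right sum_negf)
      finally show ?thesis
        by (simp add: sum.distrib[symmetric] f'_def algebra_simps)
    qed
    have "p dvd (\<Sum>x\<in>A. h x * f j x)" if "j \<in> insert i I" for j
    proof (cases "j = i")
      case True
      then show ?thesis unfolding sum_h by (simp add: f'_def)
    next
      case False
      then show ?thesis using h'(2) that unfolding sum_h by simp
    qed
    moreover have "\<exists>x\<in>A. \<not> p dvd h x"
      using h'(1) a assms(1) by (auto simp: h_def prime_dvd_mult_iff)
    ultimately show ?thesis by blast
  qed
qed

text \<open>A solution \<open>h\<close> of maximal support works. If its support were too small,
  adding the equations \<open>w s = 0\<close> for \<open>s\<close> in the support would leave the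
  system underdetermined; a nontrivial solution \<open>w\<close> of it could be added to
  \<open>h\<close> and would enlarge the support.\<close>

lemma solution_mod_prime_large_support:
  fixes p :: int and f :: "'i \<Rightarrow> 'v \<Rightarrow> int"
  assumes "prime p" "finite I" "finite A"
  obtains h where "\<And>i. i \<in> I \<Longrightarrow> p dvd (\<Sum>x\<in>A. h x * f i x)"
    and "card A \<le> card {x\<in>A. \<not> p dvd h x} + card I"
proof -
  define P where "P h \<longleftrightarrow> (\<forall>i\<in>I. p dvd (\<Sum>x\<in>A. h x * f i x))" for h
  define supp where "supp h = {x\<in>A. \<not> p dvd h x}" for h
  have "P (\<lambda>_. 0)" by (simp add: P_def)
  moreover have "\<forall>h. P h \<longrightarrow> card (supp h) < Suc (card A)"
    using assms(3) by (auto simp: supp_def less_Suc_eq_le intro!: card_mono)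
  ultimately obtain h where h: "P h" "\<And>h'. P h' \<Longrightarrow> card (supp h') \<le> card (supp h)"
    using ex_has_greatest_nat[of P _ "\<lambda>h. card (supp h)"] by blast
  have fin: "finite (supp h')" for h'
    using assms(3) by (simp add: supp_def)
  have "card A \<le> card (supp h) + card I"
  proof (rule ccontr)
    assume "\<not> ?thesis"
    then have "card (I <+> supp h) < card A"
      using assms(2) fin by (simp add: card_Plus)
    \<comment> \<open>The rows \<open>Inr s\<close> are unit vectors, so they force \<open>w\<close>
      to vanish mod \<open>p\<close> at \<open>s\<close>.\<close>
    moreover define f' where "f' = case_sum f (\<lambda>s x. if x = s then 1 else 0 :: int)"
    ultimately obtain w where w: "\<exists>x\<in>A. \<not> p dvd w x"
      "\<And>i. i \<in> I <+> supp h \<Longrightarrow> p dvd (\<Sum>x\<in>A. w x * f' i x)"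
      using underdetermined_system_mod_prime[of p "I <+> supp h" A f'] assms fin by auto
    have wI: "p dvd (\<Sum>x\<in>A. w x * f i x)" if "i \<in> I" for i
      using w(2)[OF InlI[OF that]] by (simp add: f'_def)
    have ws: "p dvd w s" if "s \<in> supp h" for s
    proof -
      have "(\<Sum>x\<in>A. w x * f' (Inr s) x) = (\<Sum>x\<in>A. if x = s then w x else 0)"
        by (intro sum.cong) (auto simp: f'_def)
      also have "\<dots> = w s"
        using that assms(3) by (simp add: supp_def)
      finally show ?thesis using w(2)[OF InrI[OF that]] by simp
    qed
    from w(1) obtain a where a: "a \<in> A" "\<not> p dvd w a" by blast
    then have "a \<notin> supp h" using ws by blast
    then have "p dvd h a" using a by (simp add: supp_def)
    have "P (\<lambda>x. h x + w x)"
      using h(1) wI by (simp add: P_def distrib_right sum.distrib)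
    then have "card (supp (\<lambda>x. h x + w x)) \<le> card (supp h)" by (rule h(2))
    moreover have "insert a (supp h) \<subseteq> supp (\<lambda>x. h x + w x)"
      using a \<open>p dvd h a\<close> ws by (auto simp: supp_def dvd_add_right_iff dvd_add_left_iff)
    then have "card (insert a (supp h)) \<le> card (supp (\<lambda>x. h x + w x))"
      using fin by (intro card_mono)
    ultimately show False
      using \<open>a \<notin> supp h\<close> fin by simp
  qed
  then show ?thesis
    using that h(1) unfolding P_def supp_def by blast
qed

text \<open>Tao's lower bound for the slice rank of a diagonal tensor of order \<open>k\<close>.
  Induction on \<open>k\<close>: contracting the last coordinate with a vector \<open>h\<close>
  orthogonal to all \<open>f k \<alpha>\<close> kills the last family of slices, and by the
  large-support lemma it costs at most \<open>card (I k)\<close> diagonal entries. The condition on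
  \<open>g i \<alpha> (x(i := v))\<close> says that this cofactor ignores coordinate
  \<open>i\<close>.\<close>

lemma card_le_slice_rank_diagonal:
  fixes p :: int and A :: "'v set" and I :: "nat \<Rightarrow> 'i set"
    and f :: "nat \<Rightarrow> 'i \<Rightarrow> 'v \<Rightarrow> int" and g :: "nat \<Rightarrow> 'i \<Rightarrow> (nat \<Rightarrow> 'v) \<Rightarrow> int"
  assumes "prime p" "2 \<le> k" "finite A" "\<And>i. i < k \<Longrightarrow> finite (I i)"
    and "\<And>i \<alpha> x v. i < k \<Longrightarrow> g i \<alpha> (x(i := v)) = g i \<alpha> x"
    and "\<And>a. a \<in> A \<Longrightarrow> \<not> p dvd c a"
    and "\<And>x. (\<And>i. i < k \<Longrightarrow> x i \<in> A) \<Longrightarrow>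
           [(if \<forall>i<k. x i = x 0 then c (x 0) else 0)
              = (\<Sum>i<k. \<Sum>\<alpha>\<in>I i. f i \<alpha> (x i) * g i \<alpha> x)] (mod p)"
  shows "card A \<le> (\<Sum>i<k. card (I i))"
  using assms(2-)
proof (induction k arbitrary: A g c rule: nat_induct_at_least)
  case base
  note indep = base(3) and c = base(4) and eq = base(5)
  have fin: "finite (I 0)" "finite (I 1)" using base(2) by auto
  have two: "{..<2} = {0, 1::nat}" by auto
  show ?case
  proof (rule ccontr)
    assume "\<not> ?thesis"
    then have "card (I 0 <+> I 1) < card A"
      using fin by (simp add: card_Plus two)
    \<comment> \<open>For order 2 this is matrix rank. Since \<open>g 0 \<alpha>\<close> ignores
      coordinate 0, it is a vector in the second coordinate; the coordinates beyond 1 are frozen at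
      \<open>undefined\<close>.\<close>
    moreover define \<phi> where
      "\<phi> = case_sum (\<lambda>\<alpha> y. g 0 \<alpha> ((\<lambda>_. undefined)(1 := y))) (f 1)"
    ultimately obtain h where h: "\<exists>a\<in>A. \<not> p dvd h a"
      "\<And>i. i \<in> I 0 <+> I 1 \<Longrightarrow> p dvd (\<Sum>x\<in>A. h x * \<phi> i x)"
      using underdetermined_system_mod_prime[of p "I 0 <+> I 1" A \<phi>] assms(1) fin base(1)
      by auto
    from h(1) obtain a where a: "a \<in> A" "\<not> p dvd h a" by blast
    \<comment> \<open>Row \<open>a\<close> of the diagonal matrix, with entries indexed by
      \<open>y\<close>. Paired with \<open>h\<close> it gives \<open>h a * c a\<close>, a unit mod
      \<open>p\<close>, although \<open>h\<close> is orthogonal to every vector in the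
      decomposition.\<close>
    define X :: "'v \<Rightarrow> nat \<Rightarrow> 'v" where "X y = (\<lambda>_. undefined)(0 := a, 1 := y)" for y
    have X: "X y 0 = a" "X y (Suc 0) = y" for y by (simp_all add: X_def)
    have "[(if y = a then c a else 0) = (\<Sum>\<alpha>\<in>I 0. f 0 \<alpha> a * \<phi> (Inl \<alpha>) y)
        + (\<Sum>\<alpha>\<in>I 1. \<phi> (Inr \<alpha>) y * g 1 \<alpha> ((\<lambda>_. undefined)(0 := a)))] (mod p)"
      if "y \<in> A" for y
    proof -
      have "X y i \<in> A" if "i < 2" for i
        using a \<open>y \<in> A\<close> that by (auto simp: X_def less_2_cases_iff)
      moreover have iff: "(\<forall>i<2. X y i = X y 0) \<longleftrightarrow> y = a"
        by (auto simp: X_def less_2_cases_iff)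
      ultimately have
        "[(if y = a then c a else 0) = (\<Sum>\<alpha>\<in>I 0. f 0 \<alpha> a * g 0 \<alpha> (X y))
          + (\<Sum>\<alpha>\<in>I 1. f 1 \<alpha> y * g 1 \<alpha> (X y))] (mod p)"
        using eq[of "X y"] X unfolding iff two by (simp split: if_splits)
      moreover have "g 0 \<alpha> (X y) = \<phi> (Inl \<alpha>) y" for \<alpha>
      proof -
        have "X y = (\<lambda>_. undefined)(1 := y, 0 := a)"
          unfolding X_def by (rule fun_upd_twist) simp
        then show ?thesis by (simp only: \<phi>_def sum.case indep)
      qed
      moreover have "g 1 \<alpha> (X y) = g 1 \<alpha> ((\<lambda>_. undefined)(0 := a))" for \<alpha>
        unfolding X_def by (rule indep) simp
      ultimately show ?thesis by (simp add: \<phi>_def)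
    qed
    then have "[(\<Sum>y\<in>A. h y * (if y = a then c a else 0)) =
        (\<Sum>y\<in>A. h y * ((\<Sum>\<alpha>\<in>I 0. f 0 \<alpha> a * \<phi> (Inl \<alpha>) y)
        + (\<Sum>\<alpha>\<in>I 1. \<phi> (Inr \<alpha>) y * g 1 \<alpha> ((\<lambda>_. undefined)(0 := a)))))] (mod p)"
      by (intro cong_sum cong_mult cong_refl)
    also have "(\<Sum>y\<in>A. h y * (if y = a then c a else 0)) = (\<Sum>y\<in>A. if y = a then h a * c a else 0)"
      by (intro sum.cong) auto
    also have "\<dots> = h a * c a"
      using a base(1) by simp
    also have "(\<Sum>y\<in>A. h y * ((\<Sum>\<alpha>\<in>I 0. f 0 \<alpha> a * \<phi> (Inl \<alpha>) y)
        + (\<Sum>\<alpha>\<in>I 1. \<phi> (Inr \<alpha>) y * g 1 \<alpha> ((\<lambda>_. undefined)(0 := a))))) =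
        (\<Sum>\<alpha>\<in>I 0. f 0 \<alpha> a * (\<Sum>y\<in>A. h y * \<phi> (Inl \<alpha>) y)) +
        (\<Sum>\<alpha>\<in>I 1. g 1 \<alpha> ((\<lambda>_. undefined)(0 := a)) * (\<Sum>y\<in>A. h y * \<phi> (Inr \<alpha>) y))"
      unfolding distrib_left sum.distrib sum_distrib_left
      by (subst (1 2) sum.swap) (simp add: mult_ac)
    finally have "p dvd h a * c a \<longleftrightarrow> p dvd
        (\<Sum>\<alpha>\<in>I 0. f 0 \<alpha> a * (\<Sum>y\<in>A. h y * \<phi> (Inl \<alpha>) y)) +
        (\<Sum>\<alpha>\<in>I 1. g 1 \<alpha> ((\<lambda>_. undefined)(0 := a)) * (\<Sum>y\<in>A. h y * \<phi> (Inr \<alpha>) y))"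
      by (rule cong_dvd_iff)
    moreover have "p dvd
        (\<Sum>\<alpha>\<in>I 0. f 0 \<alpha> a * (\<Sum>y\<in>A. h y * \<phi> (Inl \<alpha>) y)) +
        (\<Sum>\<alpha>\<in>I 1. g 1 \<alpha> ((\<lambda>_. undefined)(0 := a)) * (\<Sum>y\<in>A. h y * \<phi> (Inr \<alpha>) y))"
      by (intro dvd_add dvd_sum dvd_mult h(2)) auto
    ultimately show False
      using a c assms(1) by (auto simp: prime_dvd_mult_iff)
  qed
next
  case (Suc k)
  note indep = Suc.prems(3) and c = Suc.prems(4) and eq = Suc.prems(5)
  from solution_mod_prime_large_support[of p "I k" A "f k"] Suc.prems assms(1)
  obtain h where h: "\<And>\<alpha>. \<alpha> \<in> I k \<Longrightarrow> p dvd (\<Sum>y\<in>A. h y * f k \<alpha> y)"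
    "card A \<le> card {x\<in>A. \<not> p dvd h x} + card (I k)"
    by auto
  \<comment> \<open>Contraction with \<open>h\<close> in coordinate \<open>k\<close>; the factors
    \<open>f i \<alpha> (x i)\<close> with \<open>i < k\<close> pass through it, so only the
    cofactors change.\<close>
  define g' where "g' i \<alpha> x = (\<Sum>y\<in>A. h y * g i \<alpha> (x(k := y)))" for i \<alpha> x
  have "card {x\<in>A. \<not> p dvd h x} \<le> (\<Sum>i<k. card (I i))"
  \<comment> \<open>The contraction sums over all of \<open>A\<close>, but the remaining coordinates
    are restricted to the support of \<open>h\<close>, where the new diagonal entries
    \<open>h a * c a\<close> are units.\<close>
  proof (rule Suc.IH[where c = "\<lambda>a. h a * c a" and g = g'])
    show "finite {x\<in>A. \<not> p dvd h x}" using Suc.prems(1) by simp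
    show "finite (I i)" if "i < k" for i using Suc.prems(2) that by simp
    show "g' i \<alpha> (x(i := v)) = g' i \<alpha> x" if "i < k" for i \<alpha> x v
    proof -
      have "x(i := v, k := y) = x(k := y, i := v)" for y
        using that by (intro fun_upd_twist) simp
      then show ?thesis by (simp only: g'_def indep[OF less_SucI[OF that]])
    qed
    show "\<not> p dvd h a * c a" if "a \<in> {x\<in>A. \<not> p dvd h x}" for a
      using that c assms(1) by (simp add: prime_dvd_mult_iff)
  next
    fix x :: "nat \<Rightarrow> 'v"
    assume "\<And>i. i < k \<Longrightarrow> x i \<in> {x\<in>A. \<not> p dvd h x}"
    then have x: "x i \<in> A" if "i < k" for i using that by blast
    have "0 < k" using Suc.hyps by simp
    have "[(if (\<forall>i<k. x i = x 0) \<and> y = x 0 then c (x 0) else 0) =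
        (\<Sum>i<k. \<Sum>\<alpha>\<in>I i. f i \<alpha> (x i) * g i \<alpha> (x(k := y))) +
        (\<Sum>\<alpha>\<in>I k. f k \<alpha> y * g k \<alpha> x)] (mod p)" if "y \<in> A" for y
    proof -
      have xy: "(x(k := y)) i \<in> A" if "i < Suc k" for i
        using x that \<open>y \<in> A\<close> by (auto simp: less_Suc_eq)
      have iff: "(\<forall>i<Suc k. (x(k := y)) i = (x(k := y)) 0) \<longleftrightarrow> (\<forall>i<k. x i = x 0) \<and> y = x 0"
        using \<open>0 < k\<close> by (auto simp: less_Suc_eq)
      have sum_eq: "(\<Sum>i<k. \<Sum>\<alpha>\<in>I i. f i \<alpha> ((x(k := y)) i) * g i \<alpha> (x(k := y))) =
          (\<Sum>i<k. \<Sum>\<alpha>\<in>I i. f i \<alpha> (x i) * g i \<alpha> (x(k := y)))"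
        by (intro sum.cong) auto
      have "(x(k := y)) 0 = x 0" using \<open>0 < k\<close> by simp
      then show ?thesis
        using eq[of "x(k := y)", OF xy] unfolding iff sum.lessThan_Suc sum_eq
        by (simp only: fun_upd_same indep[OF lessI])
    qed
    then have "[(\<Sum>y\<in>A. h y * (if (\<forall>i<k. x i = x 0) \<and> y = x 0 then c (x 0) else 0)) =
        (\<Sum>y\<in>A. h y * ((\<Sum>i<k. \<Sum>\<alpha>\<in>I i. f i \<alpha> (x i) * g i \<alpha> (x(k := y))) +
        (\<Sum>\<alpha>\<in>I k. f k \<alpha> y * g k \<alpha> x)))] (mod p)"
      by (intro cong_sum cong_mult cong_refl)
    also have "(\<Sum>y\<in>A. h y * (if (\<forall>i<k. x i = x 0) \<and> y = x 0 then c (x 0) else 0)) =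
        (\<Sum>y\<in>A. if y = x 0 then if \<forall>i<k. x i = x 0 then h (x 0) * c (x 0) else 0 else 0)"
    proof -
      have "h y * (if Q \<and> y = x 0 then c (x 0) else 0) =
          (if y = x 0 then if Q then h (x 0) * c (x 0) else 0 else 0)" for Q y
        by simp
      then show ?thesis by (simp only:)
    qed
    also have "\<dots> = (if \<forall>i<k. x i = x 0 then h (x 0) * c (x 0) else 0)"
      by (simp only: sum.delta[OF Suc.prems(1)] x[OF \<open>0 < k\<close>] if_True)
    also have "(\<Sum>y\<in>A. h y * ((\<Sum>i<k. \<Sum>\<alpha>\<in>I i. f i \<alpha> (x i) * g i \<alpha> (x(k := y))) +
        (\<Sum>\<alpha>\<in>I k. f k \<alpha> y * g k \<alpha> x))) =
        (\<Sum>i<k. \<Sum>\<alpha>\<in>I i. f i \<alpha> (x i) * g' i \<alpha> x) +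
        (\<Sum>\<alpha>\<in>I k. g k \<alpha> x * (\<Sum>y\<in>A. h y * f k \<alpha> y))"
    proof -
      have "(\<Sum>y\<in>A. h y * (\<Sum>i<k. \<Sum>\<alpha>\<in>I i. f i \<alpha> (x i) * g i \<alpha> (x(k := y)))) =
          (\<Sum>i<k. \<Sum>y\<in>A. \<Sum>\<alpha>\<in>I i. f i \<alpha> (x i) * (h y * g i \<alpha> (x(k := y))))"
        unfolding sum_distrib_left by (subst sum.swap) (simp add: mult_ac)
      also have "\<dots> = (\<Sum>i<k. \<Sum>\<alpha>\<in>I i. f i \<alpha> (x i) * g' i \<alpha> x)"
        unfolding g'_def sum_distrib_left by (intro sum.cong refl sum.swap)
      finally have 1: "(\<Sum>y\<in>A. h y * (\<Sum>i<k. \<Sum>\<alpha>\<in>I i. f i \<alpha> (x i) * g i \<alpha> (x(k := y)))) = \<dots>" .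
      have 2: "(\<Sum>y\<in>A. h y * (\<Sum>\<alpha>\<in>I k. f k \<alpha> y * g k \<alpha> x)) =
          (\<Sum>\<alpha>\<in>I k. g k \<alpha> x * (\<Sum>y\<in>A. h y * f k \<alpha> y))"
        unfolding sum_distrib_left by (subst sum.swap) (simp add: mult_ac)
      show ?thesis unfolding distrib_left sum.distrib 1 2 ..
    qed
    also have "[\<dots> = (\<Sum>i<k. \<Sum>\<alpha>\<in>I i. f i \<alpha> (x i) * g' i \<alpha> x) + 0] (mod p)"
      by (intro cong_add cong_refl) (auto simp: cong_0_iff intro!: dvd_sum dvd_mult h(1))
    finally show "[(if \<forall>i<k. x i = x 0 then h (x 0) * c (x 0) else 0) =
        (\<Sum>i<k. \<Sum>\<alpha>\<in>I i. f i \<alpha> (x i) * g' i \<alpha> x)] (mod p)"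
      by simp
  qed
  with h(2) show ?case by simp
qed

section \<open>Counting monomials of low degree\<close>

text \<open>Termwise comparison of the even power series, resting on
  \<open>2 ^ n * fact n \<le> fact (2 * n)\<close>.\<close>

lemma cosh_real_le_exp_square: "cosh t \<le> exp (t\<^sup>2 / 2)" for t :: real
proof (rule sums_le)
  let ?f = "\<lambda>n. if even n then t ^ n /\<^sub>R fact n else 0"
  have "(\<lambda>n. ?f (2 * n)) sums cosh t \<longleftrightarrow> ?f sums cosh t"
    by (rule sums_mono_reindex) (auto simp: strict_mono_def)
  then show "(\<lambda>n. ?f (2 * n)) sums cosh t" using cosh_converges by blast
  show "(\<lambda>n. (t\<^sup>2 / 2) ^ n /\<^sub>R fact n) sums exp (t\<^sup>2 / 2)" by (rule exp_converges)
  show "?f (2 * n) \<le> (t\<^sup>2 / 2) ^ n /\<^sub>R fact n" for n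
  proof -
    have "2 ^ n * fact n \<le> (fact (2 * n) :: real)"
    proof (induction n)
      case (Suc n)
      have "2 ^ Suc n * fact (Suc n) = real (2 * n + 2) * (2 ^ n * fact n)"
        by (simp add: algebra_simps)
      also have "\<dots> \<le> real (2 * n + 2) * fact (2 * n)"
        using Suc by (intro mult_left_mono) auto
      also have "\<dots> \<le> real (2 * n + 2) * (real (2 * n + 1) * fact (2 * n))"
        by (intro mult_left_mono) (auto simp: algebra_simps)
      also have "\<dots> = fact (2 * Suc n)" by (simp add: algebra_simps)
      finally show ?case .
    qed simp
    then have "t ^ (2 * n) / fact (2 * n) \<le> t ^ (2 * n) / (2 ^ n * fact n)"
      by (intro divide_left_mono) auto
    moreover have "(t\<^sup>2 / 2) ^ n /\<^sub>R fact n = t ^ (2 * n) / (2 ^ n * fact n)"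
      unfolding power_divide power_mult by (simp add: divide_inverse)
    moreover have "?f (2 * n) = t ^ (2 * n) / fact (2 * n)"
      unfolding divide_inverse by simp
    ultimately show ?thesis by (simp only:)
  qed
qed

text \<open>Hoeffding's lemma for the uniform distribution on \<open>{..<p}\<close>, whose mean is
  \<open>(p - 1) / 2\<close>. Pairing \<open>v\<close> with its reflection \<open>p - 1 - v\<close>
  turns the sum into hyperbolic cosines, whose arguments are at most
  \<open>\<bar>l\<bar> * (p - 1) / 2\<close> in absolute value.\<close>

lemma sum_exp_centered_le:
  fixes l :: real
  shows "(\<Sum>v<p. exp (l * ((real p - 1) / 2 - real v))) \<le> real p * exp (l\<^sup>2 * (real p - 1)\<^sup>2 / 8)"
proof -
  define g where "g v = exp (l * ((real p - 1) / 2 - real v))" for v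
  have "2 * (\<Sum>v<p. g v) = (\<Sum>v<p. g v) + (\<Sum>v<p. g (p - Suc v))"
    using sum.nat_diff_reindex[of g p] by simp
  also have "\<dots> = (\<Sum>v<p. 2 * cosh (l * ((real p - 1) / 2 - real v)))"
    unfolding sum.distrib[symmetric]
  proof (rule sum.cong)
    fix v assume "v \<in> {..<p}"
    then have "l * ((real p - 1) / 2 - real (p - Suc v)) = - (l * ((real p - 1) / 2 - real v))"
      by (simp add: of_nat_diff algebra_simps)
    then show "g v + g (p - Suc v) = 2 * cosh (l * ((real p - 1) / 2 - real v))"
      unfolding g_def cosh_field_def by simp
  qed simp
  also have "\<dots> \<le> (\<Sum>v<p. 2 * exp (l\<^sup>2 * (real p - 1)\<^sup>2 / 8))"
  proof (intro sum_mono mult_left_mono)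
    fix v assume "v \<in> {..<p}"
    then have "0 \<le> real v * (2 * ((real p - 1) / 2) - real v)" by simp
    moreover have "(m - real v)\<^sup>2 = m\<^sup>2 - real v * (2 * m - real v)" for m
      by (simp add: power2_eq_square algebra_simps)
    ultimately have "((real p - 1) / 2 - real v)\<^sup>2 \<le> ((real p - 1) / 2)\<^sup>2" by simp
    then have "l\<^sup>2 * ((real p - 1) / 2 - real v)\<^sup>2 \<le> l\<^sup>2 * ((real p - 1) / 2)\<^sup>2"
      by (intro mult_left_mono) auto
    then have "exp ((l * ((real p - 1) / 2 - real v))\<^sup>2 / 2) \<le> exp (l\<^sup>2 * (real p - 1)\<^sup>2 / 8)"
      by (simp add: power_mult_distrib power_divide)
    then show "cosh (l * ((real p - 1) / 2 - real v)) \<le> exp (l\<^sup>2 * (real p - 1)\<^sup>2 / 8)"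
      using cosh_real_le_exp_square order_trans by blast
  qed simp
  finally show ?thesis by (simp add: g_def)
qed

text \<open>The degree bound \<open>(p - 1) n / p\<close> is multiplied through by \<open>p\<close>
  to stay within the natural numbers.\<close>

definition low_degree_exponents :: "nat \<Rightarrow> nat \<Rightarrow> (nat \<Rightarrow> nat) set" where
  "low_degree_exponents p n =
     {e \<in> {..<n} \<rightarrow>\<^sub>E {..<p}. p * (\<Sum>j<n. e j) \<le> (p - 1) * n}"

lemma finite_low_degree_exponents: "finite (low_degree_exponents p n)"
  by (simp add: low_degree_exponents_def finite_PiE)

text \<open>Chernoff's method: each admissible \<open>e\<close> gets weight at least 1 from the
  exponential of \<open>l\<close> times the gap between the threshold and its degree. Weights are
  positive, so the sum may be extended to the whole box, where it factors over the
  coordinates.\<close>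

lemma card_low_degree_exponents_le:
  assumes "2 \<le> p"
  shows "real (card (low_degree_exponents p n))
           \<le> real p ^ n * exp (- ((real p - 2)\<^sup>2 / (2 * (real p)\<^sup>2)) * real n)"
proof -
  \<comment> \<open>minimises \<open>- l (p - 1) (p - 2) / (2 p) + l\<^sup>2 (p - 1)\<^sup>2 / 8\<close>\<close>
  define l where "l = 2 * (real p - 2) / (real p * (real p - 1))"
  define K where "K = (real p - 2)\<^sup>2 / (2 * (real p)\<^sup>2)"
  have p: "real p \<ge> 2" using assms by simp
  then have l: "l \<ge> 0" by (simp add: l_def)
  have "real (card (low_degree_exponents p n)) = (\<Sum>e\<in>low_degree_exponents p n. 1)" by simp
  also have "\<dots> \<le> (\<Sum>e\<in>low_degree_exponents p n.
      \<Prod>j<n. exp (l * ((real p - 1) / real p - real (e j))))"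
  proof (rule sum_mono)
    fix e assume "e \<in> low_degree_exponents p n"
    then have "p * (\<Sum>j<n. e j) \<le> (p - 1) * n" by (simp add: low_degree_exponents_def)
    then have "real (p * (\<Sum>j<n. e j)) \<le> real ((p - 1) * n)" by (simp only: of_nat_le_iff)
    then have "real p * (\<Sum>j<n. real (e j)) \<le> (real p - 1) * real n"
      using assms by (simp add: of_nat_diff)
    then have "(\<Sum>j<n. real (e j)) \<le> real n * ((real p - 1) / real p)"
      using p by (simp add: field_simps)
    then have "0 \<le> l * (\<Sum>j<n. (real p - 1) / real p - real (e j))"
      using l by (simp add: sum_subtractf)
    then show "1 \<le> (\<Prod>j<n. exp (l * ((real p - 1) / real p - real (e j))))"
      by (simp add: exp_sum[symmetric] sum_distrib_left[symmetric])
  qed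
  also have "\<dots> \<le> (\<Sum>e\<in>{..<n} \<rightarrow>\<^sub>E {..<p}.
      \<Prod>j<n. exp (l * ((real p - 1) / real p - real (e j))))"
    by (intro sum_mono2) (auto simp: low_degree_exponents_def finite_PiE prod_nonneg)
  also have "\<dots> = (\<Prod>j<n. \<Sum>v<p. exp (l * ((real p - 1) / real p - real v)))"
    by (rule prod_sum_PiE[symmetric]) auto
  also have "\<dots> = (\<Sum>v<p. exp (l * ((real p - 1) / real p - real v))) ^ n" by simp
  also have "\<dots> \<le> (real p * exp (- K)) ^ n"
  proof (rule power_mono)
    \<comment> \<open>Recentring from the threshold \<open>(p - 1) / p\<close> per coordinate to the
      mean \<open>(p - 1) / 2\<close> makes Hoeffding's lemma applicable.\<close>
    have "(\<Sum>v<p. exp (l * ((real p - 1) / real p - real v))) =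
        exp (l * ((real p - 1) / real p - (real p - 1) / 2)) *
        (\<Sum>v<p. exp (l * ((real p - 1) / 2 - real v)))"
      unfolding sum_distrib_left mult_exp_exp
      by (intro sum.cong refl arg_cong[where f = exp]) (simp add: algebra_simps)
    also have "\<dots> \<le> exp (l * ((real p - 1) / real p - (real p - 1) / 2)) *
        (real p * exp (l\<^sup>2 * (real p - 1)\<^sup>2 / 8))"
      by (intro mult_left_mono sum_exp_centered_le) auto
    also have "\<dots> = real p *
        exp (l * ((real p - 1) / real p - (real p - 1) / 2) + l\<^sup>2 * (real p - 1)\<^sup>2 / 8)"
      by (simp add: exp_add)
    also have "l * ((real p - 1) / real p - (real p - 1) / 2) + l\<^sup>2 * (real p - 1)\<^sup>2 / 8 = - K"
    proof -
      have L: "l * (real p - 1) = 2 * (real p - 2) / real p"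
        using p by (simp add: l_def)
      have "l * (q / r - q / 2) + l\<^sup>2 * q\<^sup>2 / 8 = l * q * (1 / r - 1 / 2) + (l * q)\<^sup>2 / 8" for q r
        by (simp add: power_mult_distrib algebra_simps)
      then have "l * ((real p - 1) / real p - (real p - 1) / 2) + l\<^sup>2 * (real p - 1)\<^sup>2 / 8 =
          (l * (real p - 1)) * (1 / real p - 1 / 2) + (l * (real p - 1))\<^sup>2 / 8" .
      also have "\<dots> = - K"
        unfolding L K_def using p by (simp add: field_simps power2_eq_square)
      finally show ?thesis .
    qed
    finally show "(\<Sum>v<p. exp (l * ((real p - 1) / real p - real v))) \<le> real p * exp (- K)" .
  qed (simp add: sum_nonneg)
  also have "\<dots> = real p ^ n * exp (- K * real n)"
    by (simp add: power_mult_distrib exp_of_nat_mult[symmetric] mult.commute)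
  finally show ?thesis by (simp add: K_def)
qed

section \<open>Sets with only trivial zero-sums\<close>

text \<open>A multinomial theorem with unnamed coefficients that do not depend on \<open>y\<close>:
  a map in \<open>\<Phi>\<close> picks one summand from each of the \<open>d\<close> factors, and
  its fibre sizes are the exponents. Only the degree bound is used later.\<close>

lemma sum_power_expand_monomials:
  fixes k d :: nat
  obtains c :: "(nat \<Rightarrow> nat) \<Rightarrow> 'a :: comm_semiring_1" where
    "\<And>y. (\<Sum>i<k. y i) ^ d =
       (\<Sum>u\<in>{u \<in> {..<k} \<rightarrow>\<^sub>E {..d}. (\<Sum>i<k. u i) \<le> d}. c u * (\<Prod>i<k. y i ^ u i))"
proof -
  define U where "U = {u \<in> {..<k} \<rightarrow>\<^sub>E {..d}. (\<Sum>i<k. u i) \<le> d}"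
  define \<Phi> where "\<Phi> = {..<d} \<rightarrow>\<^sub>E {..<k}"
  define cnt where "cnt \<phi> = (\<lambda>i\<in>{..<k}. card {t \<in> {..<d}. \<phi> t = i})" for \<phi> :: "nat \<Rightarrow> nat"
  have fin: "finite \<Phi>" "finite U"
    by (simp_all add: \<Phi>_def U_def finite_PiE)
  have cnt: "cnt \<phi> \<in> U" if "\<phi> \<in> \<Phi>" for \<phi>
  proof -
    have "card {t \<in> {..<d}. \<phi> t = i} \<le> d" for i
      using card_mono[of "{..<d}" "{t \<in> {..<d}. \<phi> t = i}"] by auto
    moreover have "(\<Sum>i<k. card {t \<in> {..<d}. \<phi> t = i}) = d"
      using that sum.group[of "{..<d}" "{..<k}" \<phi> "\<lambda>_. 1::nat"] by (auto simp: \<Phi>_def)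
    ultimately show ?thesis by (auto simp: U_def cnt_def)
  qed
  have "(\<Sum>i<k. y i) ^ d =
      (\<Sum>u\<in>U. of_nat (card {\<phi> \<in> \<Phi>. cnt \<phi> = u}) * (\<Prod>i<k. y i ^ u i))" for y :: "nat \<Rightarrow> 'a"
  proof -
    have "(\<Sum>i<k. y i) ^ d = (\<Prod>t<d. \<Sum>i<k. y i)" by simp
    also have "\<dots> = (\<Sum>\<phi>\<in>\<Phi>. \<Prod>t<d. y (\<phi> t))"
      unfolding \<Phi>_def by (rule prod_sum_PiE) auto
    also have "\<dots> = (\<Sum>\<phi>\<in>\<Phi>. \<Prod>i<k. y i ^ cnt \<phi> i)"
    proof (rule sum.cong)
      fix \<phi> assume "\<phi> \<in> \<Phi>"
      then have "\<phi> ` {..<d} \<subseteq> {..<k}" by (auto simp: \<Phi>_def)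
      then have "(\<Prod>t<d. y (\<phi> t)) = (\<Prod>i<k. \<Prod>t\<in>{t. t \<in> {..<d} \<and> \<phi> t = i}. y (\<phi> t))"
        by (intro prod.group[symmetric]) auto
      also have "\<dots> = (\<Prod>i<k. \<Prod>t\<in>{t. t \<in> {..<d} \<and> \<phi> t = i}. y i)"
        by (intro prod.cong) auto
      finally show "(\<Prod>t<d. y (\<phi> t)) = (\<Prod>i<k. y i ^ cnt \<phi> i)"
        by (simp add: cnt_def)
    qed simp
    also have "\<dots> = (\<Sum>u\<in>U. \<Sum>\<phi>\<in>{\<phi>. \<phi> \<in> \<Phi> \<and> cnt \<phi> = u}. \<Prod>i<k. y i ^ cnt \<phi> i)"
      using cnt fin by (intro sum.group[symmetric]) auto
    also have "\<dots> = (\<Sum>u\<in>U. \<Sum>\<phi>\<in>{\<phi>. \<phi> \<in> \<Phi> \<and> cnt \<phi> = u}. \<Prod>i<k. y i ^ u i)"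
      by (intro sum.cong) auto
    finally show ?thesis by simp
  qed
  then show ?thesis by (rule that[folded U_def])
qed

lemma one_minus_sum_power_expand_monomials:
  fixes k d :: nat
  obtains c :: "(nat \<Rightarrow> nat) \<Rightarrow> 'a :: comm_ring_1" where
    "\<And>y. 1 - (\<Sum>i<k. y i) ^ d =
       (\<Sum>u\<in>{u \<in> {..<k} \<rightarrow>\<^sub>E {..d}. (\<Sum>i<k. u i) \<le> d}. c u * (\<Prod>i<k. y i ^ u i))"
proof -
  define U where "U = {u \<in> {..<k} \<rightarrow>\<^sub>E {..d}. (\<Sum>i<k. u i) \<le> d}"
  \<comment> \<open>Exponents of the constant monomial. They belong to \<open>U\<close> because the
    total degree is only bounded above, not fixed.\<close>
  define z :: "nat \<Rightarrow> nat" where "z = (\<lambda>i\<in>{..<k}. 0)"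
  obtain c :: "(nat \<Rightarrow> nat) \<Rightarrow> 'a" where
    c: "\<And>y. (\<Sum>i<k. y i) ^ d = (\<Sum>u\<in>U. c u * (\<Prod>i<k. y i ^ u i))"
    using sum_power_expand_monomials unfolding U_def by blast
  have "finite U" "z \<in> U" by (auto simp: U_def z_def finite_PiE)
  then have "1 = (\<Sum>u\<in>U. if u = z then 1 else 0 :: 'a)" by simp
  also have "\<dots> = (\<Sum>u\<in>U. (if u = z then 1 else 0) * (\<Prod>i<k. y i ^ u i))" for y
    by (intro sum.cong) (auto simp: z_def)
  finally have "1 = (\<Sum>u\<in>U. (if u = z then 1 else 0) * (\<Prod>i<k. y i ^ u i))" for y :: "nat \<Rightarrow> 'a" .
  then have "1 - (\<Sum>i<k. y i) ^ d =
      (\<Sum>u\<in>U. ((if u = z then 1 else 0) - c u) * (\<Prod>i<k. y i ^ u i))" for y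
    unfolding c left_diff_distrib sum_subtractf by presburger
  then show ?thesis by (rule that[folded U_def])
qed

text \<open>By Fermat's little theorem, \<open>1 - s j ^ (p - 1)\<close> is 0 mod \<open>p\<close>
  unless \<open>p\<close> divides \<open>s j\<close>, and then it is 1 because the exponent is
  positive.\<close>

lemma indicator_sum_zero_mod_prime:
  fixes p n :: nat and s :: "nat \<Rightarrow> int"
  assumes "prime p"
  shows "[(\<Prod>j<n. 1 - s j ^ (p - 1)) = (if \<forall>j<n. int p dvd s j then 1 else 0)] (mod int p)"
proof (cases "\<forall>j<n. int p dvd s j")
  case True
  have "[1 - s j ^ (p - 1) = 1] (mod int p)" if "j < n" for j
  proof -
    have "int p dvd s j ^ (p - 1)"
      using True that prime_gt_1_nat[OF assms] by (intro dvd_power_le[of _ _ 1, simplified]) auto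
    then show ?thesis by (simp add: cong_iff_dvd_diff)
  qed
  then have "[(\<Prod>j<n. 1 - s j ^ (p - 1)) = (\<Prod>j<n. 1)] (mod int p)"
    by (intro cong_prod) auto
  with True show ?thesis by simp
next
  case False
  then obtain j where j: "j < n" "\<not> int p dvd s j" by blast
  have "int p dvd 1 - s j ^ (p - 1)"
  proof -
    \<comment> \<open>Fermat's theorem is applied to the natural representative of the residue
      class.\<close>
    define a where "a = nat (s j mod int p)"
    have p: "int p > 0" using prime_gt_0_nat[OF assms] by simp
    have a: "int a = s j mod int p" using p by (simp add: a_def)
    then have "[int a = s j] (mod int p)" by (simp add: cong_def)
    then have "\<not> int p dvd int a" using j(2) cong_dvd_iff by blast
    then have "[a ^ (p - 1) = 1] (mod p)" using fermat_theorem assms by simp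
    then have "[int a ^ (p - 1) = 1] (mod int p)" by (simp flip: cong_int_iff)
    moreover have "[int a ^ (p - 1) = s j ^ (p - 1)] (mod int p)"
      using \<open>[int a = s j] (mod int p)\<close> by (rule cong_pow)
    ultimately have "[1 = s j ^ (p - 1)] (mod int p)"
      using cong_sym cong_trans by blast
    then show ?thesis by (simp add: cong_iff_dvd_diff)
  qed
  also have "\<dots> dvd (\<Prod>j<n. 1 - s j ^ (p - 1))"
    using j(1) by (intro dvd_prodI) auto
  finally show ?thesis using False by (auto simp: cong_0_iff)
qed

text \<open>Each monomial \<open>w\<close> is charged to a block \<open>low w\<close> in which its
  degree is small. Factoring out that block's monomial gives at most \<open>card M\<close> slices
  for each of the \<open>p\<close> blocks, to be compared with the lower bound
  \<open>card A\<close>.\<close>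

lemma card_le_of_only_trivial_zero_sums:
  fixes p n :: nat and A :: "(nat \<Rightarrow> int) set"
  assumes "prime p" "finite A"
    and trivial: "\<And>x. \<forall>i<p. x i \<in> A \<Longrightarrow> \<forall>j<n. int p dvd (\<Sum>i<p. x i j)
           \<Longrightarrow> \<forall>i<p. x i = x 0"
  shows "card A \<le> p * card (low_degree_exponents p n)"
proof -
  define U where "U = {u \<in> {..<p} \<rightarrow>\<^sub>E {..p - 1}. (\<Sum>i<p. u i) \<le> p - 1}"
  \<comment> \<open>Multiplying out the \<open>n\<close> factors chooses one exponent vector from
    each; \<open>w j i\<close> is the exponent of the variable \<open>x i j\<close>, and
    \<open>row w i\<close> collects the exponents of block \<open>i\<close>.\<close>
  define W where "W = {..<n} \<rightarrow>\<^sub>E U"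
  define M where "M = low_degree_exponents p n"
  define row where "row w i = (\<lambda>j\<in>{..<n}. w j i)" for w :: "nat \<Rightarrow> nat \<Rightarrow> nat" and i
  define mon where "mon e v = (\<Prod>j<n. v j ^ e j)" for e :: "nat \<Rightarrow> nat" and v :: "nat \<Rightarrow> int"
  define low where "low w = (SOME i. i < p \<and> p * (\<Sum>j<n. w j i) \<le> (p - 1) * n)"
    for w :: "nat \<Rightarrow> nat \<Rightarrow> nat"
  have p: "p \<ge> 2" using assms(1) by (rule prime_ge_2_nat)
  have finU: "finite U" by (simp add: U_def finite_PiE)
  then have finW: "finite W" by (simp add: W_def finite_PiE)
  have finM: "finite M" by (simp add: M_def finite_low_degree_exponents)
  obtain c :: "(nat \<Rightarrow> nat) \<Rightarrow> int" where
    c: "\<And>y. 1 - (\<Sum>i<p. y i) ^ (p - 1) = (\<Sum>u\<in>U. c u * (\<Prod>i<p. y i ^ u i))"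
    using one_minus_sum_power_expand_monomials unfolding U_def by blast
  define C where "C w = (\<Prod>j<n. c (w j))" for w :: "nat \<Rightarrow> nat \<Rightarrow> nat"
  have expand: "(\<Prod>j<n. 1 - (\<Sum>i<p. x i j) ^ (p - 1)) =
      (\<Sum>w\<in>W. C w * (\<Prod>i<p. mon (row w i) (x i)))" for x :: "nat \<Rightarrow> nat \<Rightarrow> int"
  proof -
    have "(\<Prod>j<n. 1 - (\<Sum>i<p. x i j) ^ (p - 1)) =
        (\<Prod>j<n. \<Sum>u\<in>U. c u * (\<Prod>i<p. x i j ^ u i))"
      by (simp only: c)
    also have "\<dots> = (\<Sum>w\<in>W. \<Prod>j<n. c (w j) * (\<Prod>i<p. x i j ^ w j i))"
      unfolding W_def by (rule prod_sum_PiE) (use finU in auto)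
    also have "\<dots> = (\<Sum>w\<in>W. C w * (\<Prod>i<p. mon (row w i) (x i)))"
    proof (rule sum.cong)
      fix w
      have "(\<Prod>j<n. \<Prod>i<p. x i j ^ w j i) = (\<Prod>i<p. \<Prod>j<n. x i j ^ w j i)"
        by (rule prod.swap)
      then show "(\<Prod>j<n. c (w j) * (\<Prod>i<p. x i j ^ w j i)) =
          C w * (\<Prod>i<p. mon (row w i) (x i))"
        by (simp add: C_def mon_def row_def prod.distrib)
    qed simp
    finally show ?thesis .
  qed
  \<comment> \<open>Pigeonhole: a monomial of total degree at most \<open>(p - 1) n\<close> has degree at most \<open>(p - 1) n / p\<close>
     in one of the \<open>p\<close> blocks of variables.\<close>
  have low: "low w < p \<and> p * (\<Sum>j<n. w j (low w)) \<le> (p - 1) * n" if "w \<in> W" for w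
  proof -
    have "\<exists>i. i < p \<and> p * (\<Sum>j<n. w j i) \<le> (p - 1) * n"
    proof (rule ccontr)
      assume "\<not> ?thesis"
      then have "(\<Sum>i<p. (p - 1) * n) < (\<Sum>i<p. p * (\<Sum>j<n. w j i))"
        using p by (intro sum_strict_mono) (auto simp: not_le lessThan_empty_iff)
      also have "\<dots> = p * (\<Sum>j<n. \<Sum>i<p. w j i)"
        by (simp add: sum_distrib_left[symmetric] sum.swap[of _ "{..<p}"])
      also have "(\<Sum>j<n. \<Sum>i<p. w j i) \<le> (\<Sum>j<n. p - 1)"
        using that by (intro sum_mono) (auto simp: W_def U_def)
      finally show False by (simp add: mult.commute)
    qed
    then show ?thesis unfolding low_def by (rule someI_ex)
  qed
  have row: "row w (low w) \<in> M" if "w \<in> W" for w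
  proof -
    have "w j i < p" if "j < n" "i < p" for i j
    proof -
      have "w j \<in> {..<p} \<rightarrow>\<^sub>E {..p - 1}"
        using \<open>w \<in> W\<close> \<open>j < n\<close> by (auto simp: W_def U_def)
      from PiE_mem[OF this, of i] have "w j i \<in> {..p - 1}" using \<open>i < p\<close> by simp
      then show ?thesis using p by auto
    qed
    then show ?thesis
      using low[OF that] by (auto simp: M_def low_degree_exponents_def row_def)
  qed
  \<comment> \<open>All monomials charged to block \<open>i\<close> with exponents
    \<open>\<alpha>\<close> there, stripped of that block, so that \<open>g i \<alpha>\<close>
    ignores \<open>x i\<close>.\<close>
  define g where "g i \<alpha> x = (\<Sum>w\<in>{w \<in> {w \<in> W. low w = i}. row w i = \<alpha>}.
      C w * (\<Prod>i'\<in>{..<p} - {i}. mon (row w i') (x i')))" for i \<alpha> and x :: "nat \<Rightarrow> nat \<Rightarrow> int"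
  have slices: "(\<Sum>w\<in>W. C w * (\<Prod>i<p. mon (row w i) (x i))) =
      (\<Sum>i<p. \<Sum>\<alpha>\<in>M. mon \<alpha> (x i) * g i \<alpha> x)" for x
  proof -
    define G where "G w = C w * (\<Prod>i<p. mon (row w i) (x i))" for w
    have "(\<Sum>w\<in>W. G w) = (\<Sum>i<p. \<Sum>w\<in>{w \<in> W. low w = i}. G w)"
      using low finW by (intro sum.group[symmetric]) auto
    also have "\<dots> = (\<Sum>i<p. \<Sum>\<alpha>\<in>M. \<Sum>w\<in>{w \<in> {w \<in> W. low w = i}. row w i = \<alpha>}. G w)"
      using row finW finM by (intro sum.cong refl sum.group[symmetric]) auto
    also have "\<dots> = (\<Sum>i<p. \<Sum>\<alpha>\<in>M. mon \<alpha> (x i) * g i \<alpha> x)"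
      unfolding g_def sum_distrib_left
    proof (intro sum.cong refl)
      fix i \<alpha> w
      assume "i \<in> {..<p}" "w \<in> {w \<in> {w \<in> W. low w = i}. row w i = \<alpha>}"
      then show "G w = mon \<alpha> (x i) * (C w * (\<Prod>i'\<in>{..<p} - {i}. mon (row w i') (x i')))"
        by (simp add: G_def prod.remove[of "{..<p}" i])
    qed
    finally show ?thesis by (simp add: G_def)
  qed
  have "card A \<le> (\<Sum>i<p. card M)"
  proof (rule card_le_slice_rank_diagonal[where p = "int p" and c = "\<lambda>_. 1" and g = g
        and f = "\<lambda>_. mon"])
    show "g i \<alpha> (x(i := v)) = g i \<alpha> x" for i \<alpha> x v
    proof -
      have "(\<Prod>i'\<in>{..<p} - {i}. mon (row w i') ((x(i := v)) i')) =
          (\<Prod>i'\<in>{..<p} - {i}. mon (row w i') (x i'))" for w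
        by (intro prod.cong) auto
      then show ?thesis by (simp only: g_def)
    qed
    show "\<not> int p dvd 1" using p by simp
    fix x :: "nat \<Rightarrow> nat \<Rightarrow> int"
    assume x: "\<And>i. i < p \<Longrightarrow> x i \<in> A"
    \<comment> \<open>Converse of \<open>trivial\<close>: a constant tuple sums to \<open>p\<close>
      times its entry.\<close>
    have "int p dvd (\<Sum>i<p. x i j)" if "\<forall>i<p. x i = x 0" for j
    proof -
      have "(\<Sum>i<p. x i j) = (\<Sum>i<p. x 0 j)"
        using that by (intro sum.cong refl) (metis lessThan_iff)
      then show ?thesis by simp
    qed
    then have iff: "(\<forall>j<n. int p dvd (\<Sum>i<p. x i j)) \<longleftrightarrow> (\<forall>i<p. x i = x 0)"
      using trivial[of x] x by blast
    show "[(if \<forall>i<p. x i = x 0 then 1 else 0) =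
        (\<Sum>i<p. \<Sum>\<alpha>\<in>M. mon \<alpha> (x i) * g i \<alpha> x)] (mod int p)"
      using indicator_sum_zero_mod_prime[OF assms(1), of "\<lambda>j. \<Sum>i<p. x i j" n]
      unfolding expand slices iff by (rule cong_sym)
  qed (use assms p finM in auto)
  then show ?thesis by (simp add: M_def)
qed

section \<open>Sequences over the group\<close>

lemma sum_mset_image_eq_sum_count:
  fixes h :: "'a \<Rightarrow> 'b :: comm_semiring_1"
  shows "(\<Sum>g\<in>#S. h g) = (\<Sum>g\<in>set_mset S. of_nat (count S g) * h g)"
proof -
  have "(\<Sum>g\<in>#S. h g) = (\<Sum>g\<in>B. of_nat (count S g) * h g)" if "finite B" "set_mset S \<subseteq> B" for B
    using that(2)
  proof (induction S)
    case (add x S)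
    have "(\<Sum>g\<in>B. of_nat (count (add_mset x S) g) * h g) =
        (\<Sum>g\<in>B. (if g = x then h g else 0) + of_nat (count S g) * h g)"
      by (intro sum.cong) (auto simp: distrib_right)
    then show ?case
      using add that(1) by (simp add: sum.distrib)
  qed simp
  then show ?thesis by simp
qed

section \<open>Coordinatewise arithmetic in \<open>Zmod_power k n\<close>\<close>

lemma carrier_Zmod_power: "0 < k \<Longrightarrow> carrier (Zmod_power k n) = {..<n} \<rightarrow>\<^sub>E {0..<int k}"
  by (simp add: Zmod_power_def carrier_integer_mod_group)

lemma one_Zmod_power: "\<one>\<^bsub>Zmod_power k n\<^esub> = (\<lambda>j\<in>{..<n}. 0)"
  by (simp add: Zmod_power_def)

lemma mult_Zmod_power:
  "x \<otimes>\<^bsub>Zmod_power k n\<^esub> y = (\<lambda>j\<in>{..<n}. (x j + y j) mod int k)"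
  by (simp add: Zmod_power_def)

lemma comm_group_Zmod_power: "comm_group (Zmod_power k n)"
proof (rule group.group_comm_groupI)
  show "group (Zmod_power k n)" by (simp add: Zmod_power_def)
qed (simp add: mult_Zmod_power add.commute)

lemma finite_carrier_Zmod_power: "0 < k \<Longrightarrow> finite (carrier (Zmod_power k n))"
  by (simp add: carrier_Zmod_power finite_PiE)

lemma pow_Zmod_power:
  "x [^]\<^bsub>Zmod_power k n\<^esub> (m::nat) = (\<lambda>j\<in>{..<n}. int m * x j mod int k)"
proof (induction m)
  case 0
  then show ?case by (simp add: one_Zmod_power)
next
  case (Suc m)
  interpret comm_group "Zmod_power k n" by (rule comm_group_Zmod_power)
  show ?case
    by (auto simp: Suc mult_Zmod_power fun_eq_iff mod_simps algebra_simps)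
qed

lemma finprod_Zmod_power:
  assumes "finite B" "f \<in> B \<rightarrow> carrier (Zmod_power k n)"
  shows "finprod (Zmod_power k n) f B = (\<lambda>j\<in>{..<n}. (\<Sum>b\<in>B. f b j) mod int k)"
  using assms
proof (induction B rule: finite_induct)
  case empty
  interpret comm_group "Zmod_power k n" by (rule comm_group_Zmod_power)
  show ?case by (simp add: one_Zmod_power)
next
  case (insert b B)
  interpret comm_group "Zmod_power k n" by (rule comm_group_Zmod_power)
  show ?case
    using insert by (auto simp: mult_Zmod_power fun_eq_iff mod_simps)
qed

text \<open>Bridge between the group notion and the coordinatewise divisibility of integers on which
  the slice rank argument runs.\<close>

lemma zero_sum_Zmod_power_iff:
  assumes "sequence_over (Zmod_power k n) S"
  shows "zero_sum (Zmod_power k n) S \<longleftrightarrow> (\<forall>j<n. int k dvd (\<Sum>g\<in>#S. g j))"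
proof -
  interpret comm_group "Zmod_power k n" by (rule comm_group_Zmod_power)
  have "seq_sum (Zmod_power k n) S =
      (\<lambda>j\<in>{..<n}. (\<Sum>g\<in>set_mset S. int (count S g) * g j) mod int k)"
  proof -
    have "(\<lambda>g. g [^]\<^bsub>Zmod_power k n\<^esub> count S g) \<in> set_mset S \<rightarrow> carrier (Zmod_power k n)"
      using assms by (auto simp: sequence_over_def)
    then show ?thesis
      unfolding seq_sum_def
      by (subst finprod_Zmod_power) (auto simp: pow_Zmod_power mod_sum_eq intro!: restrict_ext)
  qed
  then show ?thesis
    by (auto simp: zero_sum_def one_Zmod_power sum_mset_image_eq_sum_count fun_eq_iff dvd_eq_mod_eq_0)
qed

lemma group_exponent_Zmod_power:
  assumes "1 < k" "1 \<le> n"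
  shows "group_exponent (Zmod_power k n) = k"
proof -
  interpret comm_group "Zmod_power k n" by (rule comm_group_Zmod_power)
  \<comment> \<open>The all-ones vector has order exactly \<open>k\<close>, since there is at least
    one coordinate; every other order divides \<open>k\<close>.\<close>
  define e :: "nat \<Rightarrow> int" where "e = (\<lambda>j\<in>{..<n}. 1)"
  have e: "e \<in> carrier (Zmod_power k n)"
    using assms by (auto simp: e_def carrier_Zmod_power)
  have "ord e = k"
    unfolding ord_unique[OF e]
  proof
    fix m :: nat
    have "e [^]\<^bsub>Zmod_power k n\<^esub> m = \<one>\<^bsub>Zmod_power k n\<^esub> \<longleftrightarrow> (\<forall>j<n. int m mod int k = 0)"
      by (auto simp: pow_Zmod_power one_Zmod_power e_def fun_eq_iff)
    also have "\<dots> \<longleftrightarrow> k dvd m"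
      using assms(2) by (auto simp: dvd_eq_mod_eq_0 Suc_le_eq simp flip: of_nat_mod)
    finally show "e [^]\<^bsub>Zmod_power k n\<^esub> m = \<one>\<^bsub>Zmod_power k n\<^esub> \<longleftrightarrow> k dvd m" .
  qed
  moreover have "ord x dvd k" if "x \<in> carrier (Zmod_power k n)" for x
    using that by (simp add: pow_eq_id[symmetric] pow_Zmod_power one_Zmod_power)
  moreover from e have "ord e dvd Lcm (ord ` carrier (Zmod_power k n))" by (intro dvd_Lcm imageI)
  ultimately show ?thesis
    unfolding group_exponent_def by (intro dvd_antisym Lcm_least) auto
qed

section \<open>Extremal sequences and Property D\<close>

lemma zero_sum_subseq_if_count_ge:
  assumes "sequence_over (Zmod_power k n) S" "0 < k" "k \<le> count S g"
  shows "has_zero_sum_subseq (Zmod_power k n) k S"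
  unfolding has_zero_sum_subseq_def
proof (intro exI conjI)
  show "replicate_mset k g \<subseteq># S" using assms(3) by (simp add: count_le_replicate_mset_subset_eq)
  have "g \<in># S" using assms(2,3) by (metis count_greater_zero_iff order_less_le_trans)
  then have "sequence_over (Zmod_power k n) (replicate_mset k g)"
    using assms(1) by (auto simp: sequence_over_def)
  then show "zero_sum (Zmod_power k n) (replicate_mset k g)"
    by (simp add: zero_sum_Zmod_power_iff)
qed simp

text \<open>The set behind \<open>LEAST\<close> is nonempty by pigeonhole: more than
  \<open>card (carrier ?G) * (k - 1)\<close> terms force some element to occur \<open>k\<close>
  times, and these copies sum to zero. Minimality then yields a sequence one term short of the
  constant.\<close>

lemma extremal_sequence_Zmod_power:
  assumes "1 < k" "1 \<le> n"
  obtains S where "sequence_over (Zmod_power k n) S" "size S + 1 = egz_const (Zmod_power k n)"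
    "\<not> has_zero_sum_subseq (Zmod_power k n) k S"
proof -
  let ?G = "Zmod_power k n"
  define P where "P l \<longleftrightarrow> (\<forall>S. sequence_over ?G S \<and> l \<le> size S \<longrightarrow> has_zero_sum_subseq ?G k S)" for l
  have egz: "egz_const ?G = (LEAST l. P l)"
    using assms by (simp add: egz_const_def group_exponent_Zmod_power P_def)
  have "P (card (carrier ?G) * (k - 1) + 1)"
    unfolding P_def
  proof (intro allI impI)
    fix S assume S: "sequence_over ?G S \<and> card (carrier ?G) * (k - 1) + 1 \<le> size S"
    have "\<exists>g. k \<le> count S g"
    proof (rule ccontr)
      assume "\<not> ?thesis"
      then have "count S g \<le> k - 1" for g
        by (metis Suc_diff_1 Suc_leI assms(1) not_less_eq_eq not_le less_trans zero_less_one)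
      then have "size S \<le> card (set_mset S) * (k - 1)"
        unfolding size_multiset_overloaded_eq
        using sum_bounded_above[of "set_mset S" "count S" "k - 1"] by simp
      also have "\<dots> \<le> card (carrier ?G) * (k - 1)"
        using S assms by (intro mult_right_mono card_mono finite_carrier_Zmod_power)
          (auto simp: sequence_over_def)
      finally show False using S by simp
    qed
    then show "has_zero_sum_subseq ?G k S"
      using S assms zero_sum_subseq_if_count_ge by auto
  qed
  then have P: "P (egz_const ?G)"
    unfolding egz by (rule LeastI)
  \<comment> \<open>The empty sequence has no subsequence of length \<open>k > 0\<close>; hence the
    constant is positive and subtracting 1 from it does not truncate.\<close>
  have "\<not> P 0"
    using assms by (auto simp: P_def has_zero_sum_subseq_def sequence_over_def intro!: exI[of _ "{#}"])
  then have "egz_const ?G > 0" using P by (metis gr0I)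
  then have "\<not> P (egz_const ?G - 1)"
    unfolding egz by (intro not_less_Least) simp
  then obtain S where S: "sequence_over ?G S" "egz_const ?G - 1 \<le> size S"
    "\<not> has_zero_sum_subseq ?G k S"
    by (auto simp: P_def)
  moreover have "size S < egz_const ?G"
    using P S by (force simp: P_def)
  ultimately show ?thesis using that[of S] by force
qed

text \<open>The set is the support of \<open>T\<close>, which is multiplicity-free: an element
  occurring twice in \<open>T\<close> would occur at least \<open>k\<close> times in
  \<open>S\<close>. A zero-sum \<open>k\<close>-tuple over this set cannot be a subsequence of
  \<open>S\<close>, where each element has multiplicity \<open>k - 1\<close>, so it must repeat one
  element \<open>k\<close> times.\<close>

lemma property_D_extremal_set:
  assumes "property_D k n" "2 < k" "1 \<le> n"
  obtains A where "A \<subseteq> carrier (Zmod_power k n)"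
    and "egz_const (Zmod_power k n) = (k - 1) * card A + 1"
    and "\<And>x. \<forall>i<k. x i \<in> A \<Longrightarrow> \<forall>j<n. int k dvd (\<Sum>i<k. x i j)
           \<Longrightarrow> \<forall>i<k. x i = x 0"
proof -
  let ?G = "Zmod_power k n"
  obtain S where S: "sequence_over ?G S" "size S + 1 = egz_const ?G"
    "\<not> has_zero_sum_subseq ?G k S"
    using extremal_sequence_Zmod_power assms by (metis One_nat_def Suc_1 Suc_lessD)
  with assms(1) obtain T where T: "sequence_over ?G T" "S = repeat_mset (k - 1) T"
    by (auto simp: property_D_def)
  have "count T g \<le> 1" for g
  proof (rule ccontr)
    assume "\<not> ?thesis"
    then have "(k - 1) * 2 \<le> count S g" unfolding T(2) count_repeat_mset by (intro mult_left_mono) auto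
    then have "k \<le> count S g" using assms(2) by linarith
    then show False using zero_sum_subseq_if_count_ge S(1,3) assms(2) by force
  qed
  then have count_T: "count T g = 1" if "g \<in># T" for g
    using that by (metis count_greater_zero_iff One_nat_def Suc_leI le_antisym)
  show ?thesis
  proof (rule that[of "set_mset T"])
    show "set_mset T \<subseteq> carrier ?G" using T(1) by (simp add: sequence_over_def)
    have "size T = card (set_mset T)"
      unfolding size_multiset_overloaded_eq using count_T by simp
    then show "egz_const ?G = (k - 1) * card (set_mset T) + 1"
      using S(2) T(2) by simp
  next
    fix x :: "nat \<Rightarrow> nat \<Rightarrow> int"
    assume x: "\<forall>i<k. x i \<in># T" "\<forall>j<n. int k dvd (\<Sum>i<k. x i j)"
    define U where "U = image_mset x (mset_set {..<k})"
    have U_T: "set_mset U \<subseteq> set_mset T" using x(1) by (auto simp: U_def)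
    then have "sequence_over ?G U" using T(1) by (auto simp: sequence_over_def)
    then have "zero_sum ?G U"
      using x(2) by (simp add: zero_sum_Zmod_power_iff U_def image_mset.compositionality o_def
          sum_unfold_sum_mset)
    moreover have "size U = k" by (simp add: U_def)
    ultimately have "\<not> U \<subseteq># S" using S(3) by (auto simp: has_zero_sum_subseq_def)
    then obtain g where g: "count S g < count U g" by (auto simp: subseteq_mset_def not_le)
    then have "g \<in># U" by (metis count_greater_zero_iff less_zeroE not_gr_zero)
    then have "count S g = k - 1" using U_T count_T T(2) by auto
    \<comment> \<open>\<open>U\<close> has only \<open>k\<close> terms, so \<open>g\<close> takes up
      all of them.\<close>
    then have "k \<le> count U g" using g by linarith
    then have "k \<le> card {i \<in> {..<k}. x i = g}"
      by (simp add: U_def count_image_mset' eq_commute[of g])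
    then have "{i \<in> {..<k}. x i = g} = {..<k}"
      by (intro card_subset_eq) (auto intro!: antisym card_mono[of "{..<k}", simplified])
    then have "x i = g" if "i < k" for i using that by blast
    then show "\<forall>i<k. x i = x 0" using assms(2) by simp
  qed
qed

section \<open>The bound for the constant\<close>

theorem theorem1p6:
  fixes p n :: nat
  assumes "prime p" and "p > 2" and "n \<ge> 1"
    and "property_D p n"
  shows "real (egz_const (Zmod_power p n))
           \<le> (real p - 1) * real p powr
                ((1 - (real p - 2)\<^sup>2 / (2 * (real p)\<^sup>2 * ln (real p))) * real n + 1) + 1"
proof -
  let ?K = "(real p - 2)\<^sup>2 / (2 * (real p)\<^sup>2)"
  obtain A where A: "A \<subseteq> carrier (Zmod_power p n)"
    and egz: "egz_const (Zmod_power p n) = (p - 1) * card A + 1"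
    and trivial: "\<And>x. \<forall>i<p. x i \<in> A \<Longrightarrow> \<forall>j<n. int p dvd (\<Sum>i<p. x i j)
           \<Longrightarrow> \<forall>i<p. x i = x 0"
    using property_D_extremal_set[OF assms(4,2,3)] by blast
  have "finite A"
    using A finite_carrier_Zmod_power[of p n] assms(2) finite_subset by fastforce
  then have "card A \<le> p * card (low_degree_exponents p n)"
    using trivial by (intro card_le_of_only_trivial_zero_sums assms(1))
  then have "real (card A) \<le> real p * real (card (low_degree_exponents p n))"
    by (simp only: of_nat_le_iff flip: of_nat_mult)
  also have "\<dots> \<le> real p * (real p ^ n * exp (- ?K * real n))"
    using card_low_degree_exponents_le[of p n] assms(2) by (intro mult_left_mono) auto
  \<comment> \<open>Change of base: \<open>exp (- ?K)\<close> is \<open>p\<close> to the power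
    \<open>- ?K / ln p\<close>, and the \<open>+ 1\<close> in the exponent absorbs the factor
    \<open>p\<close> coming from the blocks.\<close>
  also have "\<dots> = real p powr ((1 - ?K / ln (real p)) * real n + 1)"
  proof -
    have "ln (real p) > 0" using assms(2) by simp
    then have "((1 - ?K / ln (real p)) * real n + 1) * ln (real p) =
        ln (real p) + (real n * ln (real p) + - ?K * real n)"
      by (simp add: left_diff_distrib distrib_right)
    then have "real p powr ((1 - ?K / ln (real p)) * real n + 1) =
        exp (ln (real p)) * (exp (real n * ln (real p)) * exp (- ?K * real n))"
      using assms(2) by (simp only: powr_def exp_add) simp
    then show ?thesis
      using assms(2) by (simp add: exp_of_nat_mult)
  qed
  finally have "(real p - 1) * real (card A)
      \<le> (real p - 1) * real p powr ((1 - ?K / ln (real p)) * real n + 1)"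
    using assms(2) by (intro mult_left_mono) auto
  moreover have "real (egz_const (Zmod_power p n)) = (real p - 1) * real (card A) + 1"
    using assms(2) by (simp add: egz of_nat_diff)
  ultimately show ?thesis by simp
qed

end
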